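(* Let $\mathcal C$ be a finite set, let $M\ge 1$ be an integer, and for each $m\in\{1,\ldots,M\}$ let $r_m:\mathcal C\to[0,1]$ be a fixed function. Define, for $\mathcal B\subseteq\mathcal C$, $$A_{\mathrm{SC}}(\mathcal B)=\frac1M\sum_{m=1}^{M}\left[1-\prod_{x\in\mathcal B}\bigl(1-r_m(x)\bigr)\right].$$ Let $\mathcal A\subseteq\mathcal C$ be a fixed set with $|\mathcal A|=K$ (the anchors), let $\mathcal F\subseteq\mathcal C\setminus\mathcal A$ be a fixed set (the admissible completion pool), let $B$ be an integer (the batch size), and assume that $k=B-K$ satisfies $1\le k\le|\mathcal F|$. Put $$G_{\mathcal A}(\mathcal S)=A_{\mathrm{SC}}(\mathcal A\cup\mathcal S)-A_{\mathrm{SC}}(\mathcal A).$$ Let $\mathcal S_{\mathrm{greedy}}\subseteq\mathcal F$ be a set of $k$ candidates obtained by the greedy procedure that repeatedly selects from $\mathcal F$ an exact maximum-marginal-gain candidate for $G_{\mathcal A}$, and let $$\mathcal S^\star\in\arg\max_{\mathcal S\subseteq\mathcal F,\ |\mathcal S|\le k}G_{\mathcal A}(\mathcal S).$$ Then $$G_{\mathcal A}(\mathcal S_{\mathrm{greedy}})\ \ge\ \left[1-\left(1-\frac1k\right)^k\right]G_{\mathcal A}(\mathcal S^\star)\ \ge\ \left(1-\frac1e\right)G_{\mathcal A}(\mathcal S^\star).$$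
   Context: $\mathcal C$ is a finite pool of candidate designs, and $r_m(x)\in[0,1]$ is the response of candidate $x$ under predictive scenario $m$; the responses are fixed numbers. Empty products equal $1$. Greedy procedure: set $\mathcal S_0=\varnothing$; for $i=1,\ldots,k$ choose $$x_i\in\arg\max_{x\in\mathcal F\setminus\mathcal S_{i-1}}\bigl[G_{\mathcal A}(\mathcal S_{i-1}\cup\{x\})-G_{\mathcal A}(\mathcal S_{i-1})\bigr]$$ (ties broken arbitrarily) and set $\mathcal S_i=\mathcal S_{i-1}\cup\{x_i\}$; then $\mathcal S_{\mathrm{greedy}}=\mathcal S_k$. *)

theory Defs
  imports Complex_Main
begin

definition A_SC :: "nat \<Rightarrow> (nat \<Rightarrow> 'c \<Rightarrow> real) \<Rightarrow> 'c set \<Rightarrow> real" where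
  "A_SC M r T = 1 / real M * (\<Sum>m=1..M. 1 - (\<Prod>x\<in>T. 1 - r m x))"

definition completion_gain ::
  "nat \<Rightarrow> (nat \<Rightarrow> 'c \<Rightarrow> real) \<Rightarrow> 'c set \<Rightarrow> 'c set \<Rightarrow> real" where
  "completion_gain M r A S = A_SC M r (A \<union> S) - A_SC M r A"

text \<open>Ties are broken arbitrarily, so being a greedy output is a relation: every admissible
  sequence of choices \<open>x 1, \<dots>, x k\<close> yields one.\<close>

definition greedy_output :: "('c set \<Rightarrow> real) \<Rightarrow> 'c set \<Rightarrow> nat \<Rightarrow> 'c set \<Rightarrow> bool" where
  "greedy_output G F k T \<longleftrightarrow>
    (\<exists>(x :: nat \<Rightarrow> 'c) (S :: nat \<Rightarrow> 'c set).
       S 0 = {} \<and>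
       (\<forall>i\<in>{1..k}.
          is_arg_max (\<lambda>y. G (S (i - 1) \<union> {y}) - G (S (i - 1))) (\<lambda>y. y \<in> F - S (i - 1)) (x i) \<and>
          S i = S (i - 1) \<union> {x i}) \<and>
       T = S k)"

end

theory Submission
  imports Defs
begin

text \<open>
  The bound is the classical guarantee of Nemhauser, Wolsey and Fisher for greedy maximisation of a
  monotone set function with diminishing returns under a cardinality constraint.  It holds because
  a reference set \<open>T\<close> with at most \<open>k\<close> elements can be reached from any current set \<open>S\<close> by adding
  at most \<open>k\<close> elements one after the other.  By diminishing returns each of these additions gains
  no more than it would gain at \<open>S\<close> itself, hence no more than the greedy choice gains.  So one greedy step
  closes at least the fraction \<open>1 / k\<close> of the gap between \<open>G S\<close> and \<open>G T\<close>
  (\<open>greedy_step_closes_gap\<close>), and after \<open>k\<close> steps at most the fraction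
  \<open>(1 - 1 / k) ^ k \<le> 1 / e\<close> of the initial gap is left (\<open>greedy_gap_contracts\<close>).

  The scenario coverage \<open>A_SC\<close> fits this scheme because the product of the factors
  \<open>1 - r m x\<close> is the part of scenario \<open>m\<close> that is still uncovered: adding a candidate \<open>x\<close> to \<open>T\<close>
  gains the average of \<open>r m x\<close> times the uncovered part (\<open>A_SC_marginal\<close>), which is nonnegative and
  shrinks as \<open>T\<close> grows.  Fixing the anchors restricts this function to the supersets of \<open>A\<close> and
  subtracts a constant, and neither operation affects monotonicity or diminishing returns.
\<close>

definition diminishing_returns_on :: "'c set \<Rightarrow> ('c set \<Rightarrow> real) \<Rightarrow> bool" where
  "diminishing_returns_on F G \<longleftrightarrow>
    (\<forall>S T x. S \<subseteq> T \<longrightarrow> T \<subseteq> F \<longrightarrow> x \<in> F - T \<longrightarrow>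
       G (T \<union> {x}) - G T \<le> G (S \<union> {x}) - G S)"

lemma diminishing_returns_onD:
  assumes "diminishing_returns_on F G" "S \<subseteq> T" "T \<subseteq> F" "x \<in> F - T"
  shows "G (T \<union> {x}) - G T \<le> G (S \<union> {x}) - G S"
  using assms unfolding diminishing_returns_on_def by simp

text \<open>
  Adding the elements of \<open>U\<close> to \<open>S\<close> one at a time makes the total gain telescope, and each
  summand is at most the gain of the same element at the smaller set \<open>S\<close>.
\<close>

lemma gain_le_sum_marginals:
  fixes G :: "'c set \<Rightarrow> real"
  assumes dim: "diminishing_returns_on F G"
    and "finite U" "U \<subseteq> F - S" "S \<subseteq> F"
  shows "G (S \<union> U) - G S \<le> (\<Sum>x\<in>U. G (S \<union> {x}) - G S)"
  using assms(2,3)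
proof (induction U rule: finite_induct)
  case empty
  then show ?case by simp
next
  case (insert y U)
  have "G ((S \<union> U) \<union> {y}) - G (S \<union> U) \<le> G (S \<union> {y}) - G S"
    by (rule diminishing_returns_onD[OF dim]) (use insert.hyps insert.prems \<open>S \<subseteq> F\<close> in auto)
  moreover have "G (S \<union> U) - G S \<le> (\<Sum>x\<in>U. G (S \<union> {x}) - G S)"
    by (rule insert.IH) (use insert.prems in blast)
  moreover have "S \<union> insert y U = (S \<union> U) \<union> {y}"
    by blast
  ultimately show ?case
    using insert.hyps by simp
qed

text \<open>
  All elements of \<open>T - S\<close> compete with the greedy choice, so none of the at most \<open>k\<close> marginal
  gains that bound \<open>G T - G S\<close> exceeds the greedy one.
\<close>

lemma greedy_step_closes_gap:
  fixes G :: "'c set \<Rightarrow> real"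
  assumes "finite F" and mono: "mono_on (Pow F) G" and dim: "diminishing_returns_on F G"
    and "S \<subseteq> F" "T \<subseteq> F" "card T \<le> k"
    and max: "is_arg_max (\<lambda>y. G (S \<union> {y}) - G S) (\<lambda>y. y \<in> F - S) x"
  shows "G T - G S \<le> real k * (G (S \<union> {x}) - G S)"
proof -
  have "finite T"
    using \<open>finite F\<close> \<open>T \<subseteq> F\<close> finite_subset by blast
  have x: "x \<in> F - S"
    and best: "\<And>y. y \<in> F - S \<Longrightarrow> G (S \<union> {y}) - G S \<le> G (S \<union> {x}) - G S"
    using max unfolding is_arg_max_linorder by auto
  have gain_nonneg: "0 \<le> G (S \<union> {x}) - G S"
    using mono_onD[OF mono, of S "S \<union> {x}"] x \<open>S \<subseteq> F\<close> by auto
  have "G T \<le> G (S \<union> (T - S))"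
    using mono_onD[OF mono, of T "S \<union> (T - S)"] \<open>S \<subseteq> F\<close> \<open>T \<subseteq> F\<close> by auto
  moreover have "G (S \<union> (T - S)) - G S \<le> (\<Sum>y\<in>T - S. G (S \<union> {y}) - G S)"
    using gain_le_sum_marginals[OF dim, of "T - S" S] \<open>finite T\<close> \<open>S \<subseteq> F\<close> \<open>T \<subseteq> F\<close> by auto
  moreover have "(\<Sum>y\<in>T - S. G (S \<union> {y}) - G S) \<le> real (card (T - S)) * (G (S \<union> {x}) - G S)"
    by (rule sum_bounded_above) (use best \<open>T \<subseteq> F\<close> in auto)
  moreover have "card (T - S) \<le> k"
    using card_mono[of T "T - S"] \<open>finite T\<close> \<open>card T \<le> k\<close> by auto
  then have "real (card (T - S)) * (G (S \<union> {x}) - G S) \<le> real k * (G (S \<union> {x}) - G S)"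
    using gain_nonneg by (intro mult_right_mono) auto
  ultimately show ?thesis
    by linarith
qed

text \<open>
  Closing the fraction \<open>1 / k\<close> of the gap leaves at most \<open>1 - 1 / k\<close> of it; as \<open>k \<ge> 1\<close>, this
  factor is nonnegative, so the bounds of successive steps multiply.
\<close>

lemma greedy_gap_contracts:
  fixes G :: "'c set \<Rightarrow> real" and S :: "nat \<Rightarrow> 'c set"
  assumes "finite F" and mono: "mono_on (Pow F) G" and dim: "diminishing_returns_on F G"
    and "1 \<le> k" "T \<subseteq> F" "card T \<le> k"
    and start: "S 0 = {}"
    and step: "\<And>i. i < n \<Longrightarrow>
      is_arg_max (\<lambda>y. G (S i \<union> {y}) - G (S i)) (\<lambda>y. y \<in> F - S i) (x i) \<and>
      S (Suc i) = S i \<union> {x i}"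
  shows "S n \<subseteq> F \<and> G T - G (S n) \<le> (1 - 1 / real k) ^ n * (G T - G {})"
  using step
proof (induction n)
  case 0
  then show ?case using start by simp
next
  case (Suc n)
  have "S n \<subseteq> F \<and> G T - G (S n) \<le> (1 - 1 / real k) ^ n * (G T - G {})"
    by (rule Suc.IH, rule Suc.prems, simp)
  then have IH: "S n \<subseteq> F" "G T - G (S n) \<le> (1 - 1 / real k) ^ n * (G T - G {})"
    by blast+
  have max: "is_arg_max (\<lambda>y. G (S n \<union> {y}) - G (S n)) (\<lambda>y. y \<in> F - S n) (x n)"
    and S_Suc: "S (Suc n) = S n \<union> {x n}"
    using Suc.prems[of n] by auto
  have "S (Suc n) \<subseteq> F"
    using max IH(1) S_Suc by (auto simp: is_arg_max_def)
  have "G T - G (S n) \<le> real k * (G (S (Suc n)) - G (S n))"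
    using greedy_step_closes_gap[OF \<open>finite F\<close> mono dim IH(1) \<open>T \<subseteq> F\<close> \<open>card T \<le> k\<close> max] S_Suc
    by simp
  then have "G T - G (S (Suc n)) \<le> (1 - 1 / real k) * (G T - G (S n))"
    using \<open>1 \<le> k\<close> by (simp add: field_simps)
  also have "\<dots> \<le> (1 - 1 / real k) * ((1 - 1 / real k) ^ n * (G T - G {}))"
    using IH(2) \<open>1 \<le> k\<close> by (intro mult_left_mono) auto
  finally show ?case
    using \<open>S (Suc n) \<subseteq> F\<close> by (simp add: mult.assoc)
qed

theorem greedy_output_guarantee:
  fixes G :: "'c set \<Rightarrow> real"
  assumes "finite F" "mono_on (Pow F) G" "diminishing_returns_on F G" "G {} = 0"
    and "1 \<le> k" "T \<subseteq> F" "card T \<le> k"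
    and "greedy_output G F k S"
  shows "(1 - (1 - 1 / real k) ^ k) * G T \<le> G S"
proof -
  obtain x :: "nat \<Rightarrow> 'c" and P :: "nat \<Rightarrow> 'c set" where P: "P 0 = {}" "S = P k"
    and step: "\<forall>i\<in>{1..k}.
      is_arg_max (\<lambda>y. G (P (i - 1) \<union> {y}) - G (P (i - 1))) (\<lambda>y. y \<in> F - P (i - 1)) (x i) \<and>
      P i = P (i - 1) \<union> {x i}"
    using assms(8) unfolding greedy_output_def by blast
  have "is_arg_max (\<lambda>y. G (P i \<union> {y}) - G (P i)) (\<lambda>y. y \<in> F - P i) (x (Suc i)) \<and>
      P (Suc i) = P i \<union> {x (Suc i)}" if "i < k" for i
    using bspec[OF step, of "Suc i"] that by simp
  then have "G T - G S \<le> (1 - 1 / real k) ^ k * (G T - G {})"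
    using greedy_gap_contracts[OF assms(1-3,5-7), where S = P and n = k and x = "\<lambda>i. x (Suc i)"] P
    by simp
  then show ?thesis
    using \<open>G {} = 0\<close> by (simp add: algebra_simps)
qed

lemma one_minus_inverse_power_le_inverse_e:
  assumes "1 \<le> k"
  shows "(1 - 1 / real k) ^ k \<le> 1 / exp 1"
proof -
  have "(1 - 1 / real k) ^ k \<le> exp (- (1 / real k)) ^ k"
    using assms exp_ge_add_one_self[of "- (1 / real k)"] by (intro power_mono) auto
  also have "\<dots> = exp (real k * - (1 / real k))"
    by (rule exp_of_nat_mult[symmetric])
  also have "\<dots> = 1 / exp 1"
    using assms by (simp add: exp_minus inverse_eq_divide)
  finally show ?thesis .
qed

lemma uncovered_antimono:
  fixes q :: "'c \<Rightarrow> real"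
  assumes "finite T" "S \<subseteq> T" "\<And>x. x \<in> T \<Longrightarrow> q x \<in> {0..1}"
  shows "(\<Prod>x\<in>T. 1 - q x) \<le> (\<Prod>x\<in>S. 1 - q x)"
proof -
  have "(\<Prod>x\<in>T. 1 - q x) = (\<Prod>x\<in>T - S. 1 - q x) * (\<Prod>x\<in>S. 1 - q x)"
    using assms by (intro prod.subset_diff) auto
  also have "\<dots> \<le> 1 * (\<Prod>x\<in>S. 1 - q x)"
    using assms by (intro mult_right_mono prod_le_1 prod_nonneg) (auto simp: subset_iff)
  finally show ?thesis by simp
qed

lemma A_SC_mono:
  assumes "finite T" "S \<subseteq> T" "\<And>m x. m \<in> {1..M} \<Longrightarrow> x \<in> T \<Longrightarrow> r m x \<in> {0..1}"
  shows "A_SC M r S \<le> A_SC M r T"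
  unfolding A_SC_def
  using assms by (intro mult_left_mono sum_mono diff_left_mono uncovered_antimono) auto

text \<open>
  The new factor \<open>1 - r m x\<close> scales down what \<open>T\<close> leaves uncovered in scenario \<open>m\<close>, so the candidate
  covers exactly the fraction \<open>r m x\<close> of it.  In this product form the dependence on \<open>T\<close> sits in
  the uncovered part alone, which makes diminishing returns visible.
\<close>

lemma A_SC_marginal:
  assumes "finite T" "x \<notin> T"
  shows "A_SC M r (T \<union> {x}) - A_SC M r T
       = 1 / real M * (\<Sum>m=1..M. r m x * (\<Prod>y\<in>T. 1 - r m y))"
proof -
  have "(\<Sum>m=1..M. 1 - (\<Prod>y\<in>T \<union> {x}. 1 - r m y)) - (\<Sum>m=1..M. 1 - (\<Prod>y\<in>T. 1 - r m y))
      = (\<Sum>m=1..M. r m x * (\<Prod>y\<in>T. 1 - r m y))"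
    unfolding sum_subtractf[symmetric] using assms
    by (intro sum.cong) (auto simp: algebra_simps)
  then show ?thesis
    unfolding A_SC_def by (simp only: right_diff_distrib[symmetric])
qed

lemma A_SC_diminishing_returns:
  assumes "finite C" "\<And>m x. m \<in> {1..M} \<Longrightarrow> x \<in> C \<Longrightarrow> r m x \<in> {0..1}"
  shows "diminishing_returns_on C (A_SC M r)"
  unfolding diminishing_returns_on_def
proof (intro allI impI)
  fix S T x
  assume ST: "S \<subseteq> T" "T \<subseteq> C" and x: "x \<in> C - T"
  have fin: "finite T" "finite S"
    using finite_subset[OF ST(2) \<open>finite C\<close>] finite_subset[OF ST(1)] by simp_all
  have "r m x * (\<Prod>y\<in>T. 1 - r m y) \<le> r m x * (\<Prod>y\<in>S. 1 - r m y)" if "m \<in> {1..M}" for m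
    using ST x fin assms(2)[OF that] by (intro mult_left_mono uncovered_antimono) auto
  then have "(\<Sum>m=1..M. r m x * (\<Prod>y\<in>T. 1 - r m y)) \<le> (\<Sum>m=1..M. r m x * (\<Prod>y\<in>S. 1 - r m y))"
    by (rule sum_mono)
  moreover have "x \<notin> S" "x \<notin> T"
    using ST x by auto
  ultimately show "A_SC M r (T \<union> {x}) - A_SC M r T \<le> A_SC M r (S \<union> {x}) - A_SC M r S"
    unfolding A_SC_marginal[OF fin(1) \<open>x \<notin> T\<close>] A_SC_marginal[OF fin(2) \<open>x \<notin> S\<close>]
    by (intro mult_left_mono) auto
qed

text \<open>
  Marginal gains of the completion objective at \<open>S\<close> are those of \<open>A_SC\<close> at \<open>A \<union> S\<close>.  Since \<open>F\<close>
  avoids the anchors, a candidate outside \<open>S\<close> is also new relative to \<open>A \<union> S\<close>.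
\<close>

lemma completion_gain_diminishing_returns:
  assumes dim: "diminishing_returns_on C (A_SC M r)" and "A \<subseteq> C" "F \<subseteq> C - A"
  shows "diminishing_returns_on F (completion_gain M r A)"
  unfolding diminishing_returns_on_def
proof (intro allI impI)
  fix S T x
  assume "S \<subseteq> T" "T \<subseteq> F" "x \<in> F - T"
  then have "A \<union> S \<subseteq> A \<union> T" "A \<union> T \<subseteq> C" "x \<in> C - (A \<union> T)"
    using assms by auto
  then have "A_SC M r ((A \<union> T) \<union> {x}) - A_SC M r (A \<union> T)
           \<le> A_SC M r ((A \<union> S) \<union> {x}) - A_SC M r (A \<union> S)"
    by (rule diminishing_returns_onD[OF dim])
  then show "completion_gain M r A (T \<union> {x}) - completion_gain M r A T
           \<le> completion_gain M r A (S \<union> {x}) - completion_gain M r A S"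
    unfolding completion_gain_def by (simp add: Un_assoc)
qed

lemma completion_gain_mono:
  assumes "finite C" "\<And>m x. m \<in> {1..M} \<Longrightarrow> x \<in> C \<Longrightarrow> r m x \<in> {0..1}" "A \<subseteq> C" "F \<subseteq> C"
  shows "mono_on (Pow F) (completion_gain M r A)"
proof (rule mono_onI)
  fix S T
  assume "S \<in> Pow F" "T \<in> Pow F" "S \<subseteq> T"
  then have "A \<union> S \<subseteq> A \<union> T" "A \<union> T \<subseteq> C"
    using assms by auto
  then have "A_SC M r (A \<union> S) \<le> A_SC M r (A \<union> T)"
    using assms(1,2) by (intro A_SC_mono) (auto intro: finite_subset)
  then show "completion_gain M r A S \<le> completion_gain M r A T"
    unfolding completion_gain_def by simp
qed

theorem corollary1:
  fixes C A F S_greedy S_star :: "'c set"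
    and r :: "nat \<Rightarrow> 'c \<Rightarrow> real"
    and M K k :: nat
    and B :: int
  assumes "finite C"
    and "M \<ge> 1"
    and "\<And>m x. m \<in> {1..M} \<Longrightarrow> x \<in> C \<Longrightarrow> r m x \<in> {0..1}"
    and "A \<subseteq> C"
    and "card A = K"
    and "F \<subseteq> C - A"
    and "int k = B - int K"
    and "1 \<le> k"
    and "k \<le> card F"
    and "greedy_output (completion_gain M r A) F k S_greedy"
    and "is_arg_max (completion_gain M r A) (\<lambda>S. S \<subseteq> F \<and> card S \<le> k) S_star"
  shows "completion_gain M r A S_greedy
           \<ge> (1 - (1 - 1 / real k) ^ k) * completion_gain M r A S_star
       \<and> (1 - (1 - 1 / real k) ^ k) * completion_gain M r A S_star
           \<ge> (1 - 1 / exp 1) * completion_gain M r A S_star"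
proof -
  let ?G = "completion_gain M r A"
  have "finite F" "F \<subseteq> C"
    using assms(1,6) by (auto intro: finite_subset)
  have mono: "mono_on (Pow F) ?G"
    using assms(1,3,4) \<open>F \<subseteq> C\<close> by (rule completion_gain_mono)
  have dim: "diminishing_returns_on F ?G"
    using A_SC_diminishing_returns[OF assms(1,3)] assms(4,6)
    by (rule completion_gain_diminishing_returns)
  have empty: "?G {} = 0"
    by (simp add: completion_gain_def)
  have star: "S_star \<subseteq> F" "card S_star \<le> k"
    using assms(11) by (simp_all add: is_arg_max_def)
  have "0 \<le> ?G S_star"
    using mono_onD[OF mono, of "{}" S_star] star(1) empty by simp
  then have "(1 - 1 / exp 1) * ?G S_star \<le> (1 - (1 - 1 / real k) ^ k) * ?G S_star"
    using one_minus_inverse_power_le_inverse_e[OF assms(8)] by (intro mult_right_mono) auto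
  moreover have "(1 - (1 - 1 / real k) ^ k) * ?G S_star \<le> ?G S_greedy"
    using greedy_output_guarantee[OF \<open>finite F\<close> mono dim empty assms(8) star assms(10)] .
  ultimately show ?thesis
    by blast
qed

end
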